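(* Let $\alpha:I\to E^n$ be a unit speed curve in the Euclidean space $E^n$ with Frenet frame $\{V_1,\ldots,V_n\}$ and curvatures $\kappa_1,\ldots,\kappa_{n-1}$, satisfying $\kappa_i(s)\neq 0$ for all $s\in I$ and $1\le i\le n-1$. Define functions on $I$ by $$G_1=\int\kappa_1(s)\,ds,\qquad G_2=1,\qquad G_3=\frac{\kappa_1}{\kappa_2}G_1,\qquad G_i=\frac{1}{\kappa_{i-1}}\Big[\kappa_{i-2}G_{i-2}+G_{i-1}'\Big]\quad (4\le i\le n).$$ Then $\alpha$ is a slant helix if and only if (for some choice of the antiderivative $G_1$ of $\kappa_1$) the function $$\sum_{i=1}^{n}G_i^2=C$$ is constant and non-zero. Moreover, the constant is $C=\sec^2\theta$, where $\theta$ is the angle that $V_2$ makes with the fixed direction $U$ that determines $\alpha$ as a slant helix.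
   Context: $E^n$ is $\mathbb R^n$ with the standard scalar product $\langle X,Y\rangle=\sum_{i=1}^n x_iy_i$; here $n\ge 3$, and $I\subset\mathbb R$ is an open interval. Curves and curvature functions are assumed differentiable as often as needed (smooth). A curve $\alpha$ is of unit speed if $\langle\alpha'(s),\alpha'(s)\rangle=1$ for all $s\in I$. Primes denote $d/ds$. Frenet frame: $\{V_1(s),\ldots,V_n(s)\}$ is the orthonormal moving frame along $\alpha$ with $V_1=\alpha'$ satisfying the Frenet equations $$V_1'=\kappa_1V_2,\qquad V_i'=-\kappa_{i-1}V_{i-1}+\kappa_iV_{i+1}\ (2\le i\le n-1),\qquad V_n'=-\kappa_{n-1}V_{n-1}.$$ The function $\kappa_i(s)$ is the $i$-th curvature of $\alpha$, and $V_2$ is the unit principal normal. Slant helix: a unit speed curve $\alpha:I\to E^n$ is called a slant helix if its unit principal normal $V_2$ makes a constant angle $\theta$ with a fixed direction $U$, i.e. there is a constant vector $U$ with $\langle U,U\rangle=1$ such that $\langle V_2(s),U\rangle=\cos\theta$ for all $s\in I$, with $\theta$ constant. $\int\kappa_1(s)\,ds$ denotes an indefinite integral (antiderivative) of $\kappa_1$ on $I$.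
   Formalization: The angle θ is required to satisfy cos θ ≠ 0 (circular helices with θ = π/2 violate the claim), and for n ≥ 4 the function G_n is required not to vanish identically on any open subinterval of I (otherwise a constant sum need not give a slant helix). *)

theory Defs
  imports "HOL-Analysis.Analysis"
begin

primrec times_differentiable_on :: "nat \<Rightarrow> real set \<Rightarrow> (real \<Rightarrow> 'a::real_normed_vector) \<Rightarrow> bool" where
  "times_differentiable_on 0 I f = True"
| "times_differentiable_on (Suc k) I f =
     ((\<forall>s\<in>I. f differentiable (at s)) \<and>
      times_differentiable_on k I (\<lambda>s. vector_derivative f (at s)))"

text \<open>The derivatives above are two-sided, so this notion is meant for open \<open>I\<close>.\<close>

definition smooth_on :: "real set \<Rightarrow> (real \<Rightarrow> 'a::real_normed_vector) \<Rightarrow> bool" where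
  "smooth_on I f \<longleftrightarrow> (\<forall>k. times_differentiable_on k I f)"

definition unit_speed_on :: "real set \<Rightarrow> (real \<Rightarrow> real ^ 'n) \<Rightarrow> bool" where
  "unit_speed_on I \<alpha> \<longleftrightarrow>
     (\<forall>s\<in>I. vector_derivative \<alpha> (at s) \<bullet> vector_derivative \<alpha> (at s) = 1)"

text \<open>Frame vectors \<open>V i\<close> are indexed by \<open>1, \<dots>, n\<close> and curvatures \<open>\<kappa> i\<close> by
  \<open>1, \<dots>, n - 1\<close>, where \<open>n = CARD('n)\<close>; values at other indices are irrelevant.\<close>

definition frenet_frame ::
  "real set \<Rightarrow> (real \<Rightarrow> real ^ 'n) \<Rightarrow> (nat \<Rightarrow> real \<Rightarrow> real ^ 'n) \<Rightarrow> (nat \<Rightarrow> real \<Rightarrow> real) \<Rightarrow> bool" where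
  "frenet_frame I \<alpha> V \<kappa> \<longleftrightarrow>
     (\<forall>s\<in>I. \<forall>i\<in>{1..CARD('n)}. \<forall>j\<in>{1..CARD('n)}. V i s \<bullet> V j s = (if i = j then 1 else 0)) \<and>
     (\<forall>s\<in>I. (\<alpha> has_vector_derivative V 1 s) (at s)) \<and>
     (\<forall>s\<in>I. (V 1 has_vector_derivative \<kappa> 1 s *\<^sub>R V 2 s) (at s)) \<and>
     (\<forall>s\<in>I. \<forall>i\<in>{2..CARD('n) - 1}.
        (V i has_vector_derivative (- \<kappa> (i - 1) s) *\<^sub>R V (i - 1) s + \<kappa> i s *\<^sub>R V (i + 1) s) (at s)) \<and>
     (\<forall>s\<in>I. (V CARD('n) has_vector_derivative
        (- \<kappa> (CARD('n) - 1) s) *\<^sub>R V (CARD('n) - 1) s) (at s))"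

text \<open>\<open>slant_helix_with I N U \<theta>\<close>: the curve with unit principal normal \<open>N\<close> is a slant helix
  with fixed direction \<open>U\<close> and constant angle \<open>\<theta>\<close>.\<close>

definition slant_helix_with :: "real set \<Rightarrow> (real \<Rightarrow> real ^ 'n) \<Rightarrow> real ^ 'n \<Rightarrow> real \<Rightarrow> bool" where
  "slant_helix_with I N U \<theta> \<longleftrightarrow> U \<bullet> U = 1 \<and> (\<forall>s\<in>I. N s \<bullet> U = cos \<theta>)"

definition antiderivative_on :: "real set \<Rightarrow> (real \<Rightarrow> real) \<Rightarrow> (real \<Rightarrow> real) \<Rightarrow> bool" where
  "antiderivative_on I f g \<longleftrightarrow> (\<forall>s\<in>I. (g has_real_derivative f s) (at s))"

text \<open>\<open>slant_G \<kappa> g i\<close> is \<open>G\<^sub>i\<close> for the choice \<open>G\<^sub>1 = g\<close>.  The last equation is the recursion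
  at index \<open>i = k + 4\<close>; the value at index \<open>0\<close> is a dummy.\<close>

fun slant_G :: "(nat \<Rightarrow> real \<Rightarrow> real) \<Rightarrow> (real \<Rightarrow> real) \<Rightarrow> nat \<Rightarrow> real \<Rightarrow> real" where
  "slant_G \<kappa> g 0 = (\<lambda>s. 0)"
| "slant_G \<kappa> g (Suc 0) = g"
| "slant_G \<kappa> g (Suc (Suc 0)) = (\<lambda>s. 1)"
| "slant_G \<kappa> g (Suc (Suc (Suc 0))) = (\<lambda>s. \<kappa> 1 s / \<kappa> 2 s * g s)"
| "slant_G \<kappa> g (Suc (Suc (Suc (Suc k)))) =
     (\<lambda>s. 1 / \<kappa> (k + 3) s *
        (\<kappa> (k + 2) s * slant_G \<kappa> g (Suc (Suc k)) s + deriv (slant_G \<kappa> g (Suc (Suc (Suc k)))) s))"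

text \<open>For \<open>n \<ge> 4\<close>, constancy of \<open>\<Sum>i=1..n. G\<^sub>i\<^sup>2\<close> only yields
  \<open>G\<^sub>n (G\<^sub>n' + \<kappa>\<^bsub>n-1\<^esub> G\<^bsub>n-1\<^esub>) = 0\<close>, whereas a slant helix needs the second factor to vanish.
  For instance \<open>n = 4\<close>, \<open>\<kappa>\<^sub>1 = cos\<close>, \<open>\<kappa>\<^sub>2 = sin\<close>, \<open>\<kappa>\<^sub>3 = 1\<close>, \<open>G\<^sub>1 = sin\<close> on \<open>{0<..<pi/2}\<close> gives
  \<open>G\<^sub>3 = cos\<close>, \<open>G\<^sub>4 = 0\<close> and the constant sum \<open>2\<close>, but the curve is not a slant helix.
  The condition below, applied to \<open>G\<^sub>n\<close>, excludes exactly this degeneration.\<close>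

definition nonzero_on_subintervals :: "real set \<Rightarrow> (real \<Rightarrow> real) \<Rightarrow> bool" where
  "nonzero_on_subintervals I f \<longleftrightarrow>
     (\<forall>a b. a < b \<and> {a<..<b} \<subseteq> I \<longrightarrow> (\<exists>s\<in>{a<..<b}. f s \<noteq> 0))"

end

theory Submission
  imports Defs
begin

text \<open>
  Put \<open>u\<^sub>i = \<langle>V\<^sub>i, U\<rangle>\<close>.  If \<open>u\<^sub>2\<close> is a constant \<open>c \<noteq> 0\<close>, the Frenet equations turn into the recursion
  of the \<open>G\<^sub>i\<close> for \<open>u\<^sub>i / c\<close>, and Parseval's identity gives the sum \<open>1 / c\<^sup>2\<close>; if \<open>u\<^sub>n\<close> vanished on an
  interval, the Frenet equations read downwards would make \<open>u\<^sub>2\<close> vanish there.  Conversely, the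
  derivative of \<open>\<Sum> G\<^sub>i V\<^sub>i\<close> is \<open>R V\<^sub>n\<close> with \<open>R = G\<^sub>n' + \<kappa>\<^bsub>n-1\<^esub> G\<^bsub>n-1\<^esub>\<close>, and differentiating
  \<open>\<Sum> G\<^sub>i\<^sup>2 = C\<close> gives \<open>G\<^sub>n R = 0\<close>.  Since \<open>R\<close> is continuous and \<open>G\<^sub>n\<close> vanishes on no interval (for \<open>n = 3\<close>
  it has no zero at all), \<open>R = 0\<close>, so \<open>U = C\<^bsup>-1/2\<^esup> \<Sum> G\<^sub>i V\<^sub>i\<close> is a constant unit vector.
\<close>

section \<open>Smooth real functions\<close>

lemma vector_derivative_eq_deriv: "vector_derivative f (at s) = deriv f s"
  for f :: "real \<Rightarrow> real"
  by (simp add: vector_derivative_def deriv_def has_real_derivative_iff_has_vector_derivative)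

text \<open>A derivative depends only on values near the point, and openness of \<open>I\<close>
  supplies such a neighbourhood.\<close>

lemma times_differentiable_on_cong:
  assumes "open I" "\<And>s. s \<in> I \<Longrightarrow> f s = g s" "times_differentiable_on k I f"
  shows "times_differentiable_on k I g"
  using assms(2,3)
proof (induction k arbitrary: f g)
  case (Suc k)
  have d: "(g has_vector_derivative vector_derivative f (at s)) (at s)" if "s \<in> I" for s
  proof -
    have "(f has_vector_derivative vector_derivative f (at s)) (at s)"
      using Suc.prems(2) that by (simp add: vector_derivative_works)
    then show ?thesis
      using has_vector_derivative_transform_within_open[OF _ assms(1) that] Suc.prems(1) by blast
  qed
  have "times_differentiable_on k I (\<lambda>s. vector_derivative g (at s))"
    by (rule Suc.IH[of "\<lambda>s. vector_derivative f (at s)"])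
      (use Suc.prems(2) in \<open>simp_all add: vector_derivative_at[OF d]\<close>)
  with d show ?case
    by (auto intro: differentiableI_vector)
qed simp

text \<open>Any derivative known on \<open>I\<close> may replace the
  \<open>vector_derivative\<close> fixed by the definition, so the inductions below can use the
  usual differentiation rules.\<close>

lemma times_differentiable_on_SucI:
  assumes "open I" "\<And>s. s \<in> I \<Longrightarrow> (f has_vector_derivative f' s) (at s)"
    and "times_differentiable_on k I f'"
  shows "times_differentiable_on (Suc k) I f"
proof -
  have "times_differentiable_on k I (\<lambda>s. vector_derivative f (at s))"
    by (rule times_differentiable_on_cong[OF assms(1) _ assms(3)])
      (simp add: vector_derivative_at[OF assms(2)])
  then show ?thesis
    using assms(2) by (auto intro: differentiableI_vector)
qed

lemma times_differentiable_on_SucE: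
  assumes "times_differentiable_on (Suc k) I f"
  obtains f' where "\<And>s. s \<in> I \<Longrightarrow> (f has_vector_derivative f' s) (at s)"
    and "times_differentiable_on k I f'"
  using assms by (intro that[of "\<lambda>s. vector_derivative f (at s)"]) (auto simp: vector_derivative_works)

lemma times_differentiable_on_Suc_imp:
  "times_differentiable_on (Suc k) I f \<Longrightarrow> times_differentiable_on k I f"
  by (induction k arbitrary: f) auto

lemma times_differentiable_on_add:
  assumes "open I" "times_differentiable_on k I f" "times_differentiable_on k I g"
  shows "times_differentiable_on k I (\<lambda>s. f s + g s)"
  using assms(2,3)
proof (induction k arbitrary: f g)
  case (Suc k)
  obtain f' where f: "\<And>s. s \<in> I \<Longrightarrow> (f has_vector_derivative f' s) (at s)"
    and f': "times_differentiable_on k I f'"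
    using times_differentiable_on_SucE[OF Suc.prems(1)] by blast
  obtain g' where g: "\<And>s. s \<in> I \<Longrightarrow> (g has_vector_derivative g' s) (at s)"
    and g': "times_differentiable_on k I g'"
    using times_differentiable_on_SucE[OF Suc.prems(2)] by blast
  show ?case
    by (intro times_differentiable_on_SucI[OF assms(1) _ Suc.IH[OF f' g']]
        has_vector_derivative_add f g)
qed simp

lemma times_differentiable_on_mult:
  fixes f g :: "real \<Rightarrow> real"
  assumes "open I" "times_differentiable_on k I f" "times_differentiable_on k I g"
  shows "times_differentiable_on k I (\<lambda>s. f s * g s)"
  using assms(2,3)
proof (induction k arbitrary: f g)
  case (Suc k)
  obtain f' where f: "\<And>s. s \<in> I \<Longrightarrow> (f has_vector_derivative f' s) (at s)"
    and f': "times_differentiable_on k I f'"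
    using times_differentiable_on_SucE[OF Suc.prems(1)] by blast
  obtain g' where g: "\<And>s. s \<in> I \<Longrightarrow> (g has_vector_derivative g' s) (at s)"
    and g': "times_differentiable_on k I g'"
    using times_differentiable_on_SucE[OF Suc.prems(2)] by blast
  \<comment> \<open>In the product rule \<open>f\<close> and \<open>g\<close> reappear
    undifferentiated, so their order is lowered to \<open>k\<close> before the induction hypothesis
    applies.\<close>
  have "times_differentiable_on k I (\<lambda>s. f s * g' s + f' s * g s)"
    by (rule times_differentiable_on_add[OF assms(1)
          Suc.IH[OF times_differentiable_on_Suc_imp[OF Suc.prems(1)] g']
          Suc.IH[OF f' times_differentiable_on_Suc_imp[OF Suc.prems(2)]]])
  then show ?case
    by (rule times_differentiable_on_SucI[OF assms(1), rotated])
      (rule has_vector_derivative_mult[OF f g])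
qed simp

lemma times_differentiable_on_const:
  "open I \<Longrightarrow> times_differentiable_on k I (\<lambda>s. c)"
  by (induction k arbitrary: c) auto

text \<open>The derivative -f'/f^2 of 1/f contains 1/f again, which the induction hypothesis covers
  at one order less.\<close>

lemma times_differentiable_on_inverse:
  fixes f :: "real \<Rightarrow> real"
  assumes "open I" "\<And>s. s \<in> I \<Longrightarrow> f s \<noteq> 0" "times_differentiable_on k I f"
  shows "times_differentiable_on k I (\<lambda>s. inverse (f s))"
  using assms(3)
proof (induction k)
  case (Suc k)
  obtain f' where f: "\<And>s. s \<in> I \<Longrightarrow> (f has_vector_derivative f' s) (at s)"
    and f': "times_differentiable_on k I f'"
    using times_differentiable_on_SucE[OF Suc.prems(1)] by blast
  have inv: "times_differentiable_on k I (\<lambda>s. inverse (f s))"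
    by (rule Suc.IH[OF times_differentiable_on_Suc_imp[OF Suc.prems]])
  have "times_differentiable_on k I (\<lambda>s. - 1 * (inverse (f s) * (f' s * inverse (f s))))"
    by (rule times_differentiable_on_mult[OF assms(1) times_differentiable_on_const[OF assms(1)]
          times_differentiable_on_mult[OF assms(1) inv times_differentiable_on_mult[OF assms(1) f' inv]]])
  moreover have "((\<lambda>s. inverse (f s)) has_vector_derivative
      - 1 * (inverse (f s) * (f' s * inverse (f s)))) (at s)" if "s \<in> I" for s
    using DERIV_inverse_fun[of f "f' s" s UNIV] f[OF that] assms(2)[OF that]
    by (simp add: has_real_derivative_iff_has_vector_derivative field_simps)
  ultimately show ?case
    by (rule times_differentiable_on_SucI[OF assms(1), rotated])
qed simp

lemma smooth_on_const: "open I \<Longrightarrow> smooth_on I (\<lambda>s. c)"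
  by (simp add: smooth_on_def times_differentiable_on_const)

lemma smooth_on_add:
  "open I \<Longrightarrow> smooth_on I f \<Longrightarrow> smooth_on I g \<Longrightarrow> smooth_on I (\<lambda>s. f s + g s)"
  by (simp add: smooth_on_def times_differentiable_on_add)

lemma smooth_on_mult:
  fixes f g :: "real \<Rightarrow> real"
  shows "open I \<Longrightarrow> smooth_on I f \<Longrightarrow> smooth_on I g \<Longrightarrow> smooth_on I (\<lambda>s. f s * g s)"
  by (simp add: smooth_on_def times_differentiable_on_mult)

lemma smooth_on_divide:
  fixes f g :: "real \<Rightarrow> real"
  assumes "open I" "smooth_on I f" "smooth_on I g" "\<And>s. s \<in> I \<Longrightarrow> g s \<noteq> 0"
  shows "smooth_on I (\<lambda>s. f s / g s)"
proof -
  have "smooth_on I (\<lambda>s. inverse (g s))"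
    using assms by (simp add: smooth_on_def times_differentiable_on_inverse)
  from smooth_on_mult[OF assms(1,2) this] show ?thesis
    by (simp add: divide_inverse)
qed

lemma smooth_on_deriv:
  fixes f :: "real \<Rightarrow> real"
  assumes "smooth_on I f"
  shows "smooth_on I (deriv f)"
  unfolding smooth_on_def
proof
  fix k
  have "times_differentiable_on (Suc k) I f"
    using assms unfolding smooth_on_def by blast
  then show "times_differentiable_on k I (deriv f)"
    by (simp add: vector_derivative_eq_deriv)
qed

lemma smooth_on_antiderivative:
  assumes "open I" "smooth_on I f" "antiderivative_on I f g"
  shows "smooth_on I g"
  unfolding smooth_on_def
proof
  fix k
  have "times_differentiable_on (Suc k) I g"
    using assms unfolding smooth_on_def antiderivative_on_def
    by (intro times_differentiable_on_SucI[where f' = f])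
      (auto simp: has_real_derivative_iff_has_vector_derivative)
  then show "times_differentiable_on k I g"
    by (rule times_differentiable_on_Suc_imp)
qed

lemma smooth_on_DERIV:
  fixes f :: "real \<Rightarrow> real"
  assumes "smooth_on I f" "s \<in> I"
  shows "(f has_real_derivative deriv f s) (at s)"
proof -
  have "times_differentiable_on (Suc 0) I f"
    using assms(1) unfolding smooth_on_def by blast
  then show ?thesis
    using assms(2) by (simp add: vector_derivative_works vector_derivative_eq_deriv
        has_real_derivative_iff_has_vector_derivative)
qed

lemma smooth_on_isCont:
  fixes f :: "real \<Rightarrow> real"
  assumes "smooth_on I f" "s \<in> I"
  shows "isCont f s"
  using smooth_on_DERIV[OF assms] by (rule DERIV_isCont)

section \<open>Local constancy and vanishing products on open sets\<close>

lemma DERIV_zero_if_constant_on_open: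
  fixes f :: "real \<Rightarrow> real"
  assumes "open S" "s \<in> S" "\<And>t. t \<in> S \<Longrightarrow> f t = c"
  shows "(f has_real_derivative 0) (at s)"
  by (rule has_field_derivative_transform_within_open[of "\<lambda>_. c", OF _ assms(1,2)])
    (simp_all add: assms(3))

text \<open>Where \<open>R\<close> is nonzero, continuity keeps it nonzero on a whole interval, and
  there \<open>f\<close> would have to vanish identically.\<close>

lemma zero_on_open_of_mult_eq_0:
  fixes f R :: "real \<Rightarrow> real"
  assumes "open I" "nonzero_on_subintervals I f" "\<And>s. s \<in> I \<Longrightarrow> f s * R s = 0"
    and "s \<in> I" "isCont R s"
  shows "R s = 0"
proof (rule ccontr)
  assume "R s \<noteq> 0"
  then obtain d where d: "d > 0" "\<And>t. \<bar>s - t\<bar> < d \<Longrightarrow> R t \<noteq> 0"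
    using continuous_at_avoid[OF assms(5), of 0] by (auto simp: dist_real_def)
  obtain e where e: "e > 0" "ball s e \<subseteq> I"
    using assms(1,4) openE by blast
  define m where "m = min d e"
  have "m > 0" "\<And>t. t \<in> {s - m<..<s + m} \<Longrightarrow> R t \<noteq> 0 \<and> t \<in> I"
    using d e by (auto simp: m_def subset_iff dist_real_def)
  moreover from this have "\<exists>t\<in>{s - m<..<s + m}. f t \<noteq> 0"
    using assms(2) unfolding nonzero_on_subintervals_def by (smt (verit) subsetI)
  ultimately show False
    using assms(3) by fastforce
qed

section \<open>The Frenet frame\<close>

text \<open>Orthonormal vectors are independent, so \<open>CARD('n)\<close> of them span the space.
  The remainder \<open>?W\<close> is orthogonal to each of them, hence to itself, and is therefore
  zero.\<close>

lemma orthonormal_expansion: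
  fixes v :: "nat \<Rightarrow> real ^ 'n"
  assumes "\<And>i j. \<lbrakk>i \<in> {1..CARD('n)}; j \<in> {1..CARD('n)}\<rbrakk> \<Longrightarrow> v i \<bullet> v j = (if i = j then 1 else 0)"
  shows "(\<Sum>i=1..CARD('n). (v i \<bullet> U) *\<^sub>R v i) = U"
proof -
  let ?A = "{1..CARD('n)}"
  let ?W = "U - (\<Sum>i\<in>?A. (v i \<bullet> U) *\<^sub>R v i)"
  have inj: "inj_on v ?A"
    using assms by (intro inj_onI) (metis zero_neq_one)
  have W: "v j \<bullet> ?W = 0" if "j \<in> ?A" for j
  proof -
    have "(\<Sum>i\<in>?A. (v i \<bullet> U) * (v j \<bullet> v i)) = (\<Sum>i\<in>?A. if i = j then v i \<bullet> U else 0)"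
      using assms that by (intro sum.cong) auto
    then show ?thesis
      using that by (simp add: inner_diff_right inner_sum_right)
  qed
  have orth: "pairwise orthogonal (v ` ?A)"
    using assms by (auto simp: pairwise_def orthogonal_def)
  have "0 \<notin> v ` ?A"
    using assms by (metis imageE inner_zero_left zero_neq_one)
  with orth have "independent (v ` ?A)"
    by (rule pairwise_orthogonal_independent)
  then have "UNIV \<subseteq> span (v ` ?A)"
    using card_image[OF inj] by (intro card_ge_dim_independent) simp_all
  moreover have "orthogonal ?W x" if "x \<in> span (v ` ?A)" for x
  proof (rule orthogonal_to_span[OF that])
    fix y assume "y \<in> v ` ?A"
    then obtain j where "j \<in> ?A" "y = v j"
      by blast
    with W[of j] show "orthogonal ?W y"
      by (simp only: orthogonal_def inner_commute[of ?W])
  qed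
  ultimately have "orthogonal ?W ?W"
    by blast
  then show ?thesis
    by (simp add: orthogonal_def)
qed

lemma orthonormal_parseval:
  fixes v :: "nat \<Rightarrow> real ^ 'n"
  assumes "\<And>i j. \<lbrakk>i \<in> {1..CARD('n)}; j \<in> {1..CARD('n)}\<rbrakk> \<Longrightarrow> v i \<bullet> v j = (if i = j then 1 else 0)"
  shows "(\<Sum>i=1..CARD('n). (v i \<bullet> U)\<^sup>2) = U \<bullet> U"
proof -
  have "U \<bullet> U = (\<Sum>i=1..CARD('n). (v i \<bullet> U) *\<^sub>R v i) \<bullet> U"
    using orthonormal_expansion[OF assms, of U] by simp
  then show ?thesis
    by (simp add: inner_sum_left power2_eq_square)
qed

text \<open>Extending the curvatures by \<open>\<kappa>\<^sub>0 = \<kappa>\<^sub>n = 0\<close> makes the Frenet equations uniform in the index.\<close>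

definition ext_curv :: "nat \<Rightarrow> (nat \<Rightarrow> real \<Rightarrow> real) \<Rightarrow> nat \<Rightarrow> real \<Rightarrow> real" where
  "ext_curv n \<kappa> i s = (if i \<in> {1..<n} then \<kappa> i s else 0)"

lemma ext_curv_simps [simp]:
  "ext_curv n \<kappa> 0 s = 0" "ext_curv n \<kappa> n s = 0"
  "1 \<le> i \<Longrightarrow> i < n \<Longrightarrow> ext_curv n \<kappa> i s = \<kappa> i s"
  by (auto simp: ext_curv_def)

lemma frenet_frame_orthonormal:
  fixes V :: "nat \<Rightarrow> real \<Rightarrow> real ^ 'n"
  assumes "frenet_frame I \<alpha> V \<kappa>" "s \<in> I" "i \<in> {1..CARD('n)}" "j \<in> {1..CARD('n)}"
  shows "V i s \<bullet> V j s = (if i = j then 1 else 0)"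
  using assms unfolding frenet_frame_def by blast

text \<open>The meaningless vectors \<open>V 0\<close> and \<open>V (CARD('n) + 1)\<close> appear at
  the two end indices, but the extended curvatures in front of them are zero.\<close>

lemma frenet_frame_derivative:
  fixes V :: "nat \<Rightarrow> real \<Rightarrow> real ^ 'n"
  assumes "frenet_frame I \<alpha> V \<kappa>" "s \<in> I" "i \<in> {1..CARD('n)}" "CARD('n) \<ge> 3"
  shows "(V i has_vector_derivative
    ext_curv CARD('n) \<kappa> i s *\<^sub>R V (i + 1) s - ext_curv CARD('n) \<kappa> (i - 1) s *\<^sub>R V (i - 1) s) (at s)"
proof -
  consider "i = 1" | "i \<in> {2..CARD('n) - 1}" | "i = CARD('n)"
    using assms(3) by fastforce
  then show ?thesis
  proof cases
    case 1
    have "(V 1 has_vector_derivative \<kappa> 1 s *\<^sub>R V 2 s) (at s)"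
      using assms unfolding frenet_frame_def by blast
    with 1 assms(4) show ?thesis
      by (simp add: numeral_2_eq_2)
  next
    case 2
    then have "(V i has_vector_derivative
        (- \<kappa> (i - 1) s) *\<^sub>R V (i - 1) s + \<kappa> i s *\<^sub>R V (i + 1) s) (at s)"
      using assms unfolding frenet_frame_def by blast
    moreover have "ext_curv CARD('n) \<kappa> i s = \<kappa> i s" "ext_curv CARD('n) \<kappa> (i - 1) s = \<kappa> (i - 1) s"
      using 2 assms(4) by (auto simp: ext_curv_def)
    ultimately show ?thesis
      by simp
  next
    case 3
    have "(V CARD('n) has_vector_derivative
        (- \<kappa> (CARD('n) - 1) s) *\<^sub>R V (CARD('n) - 1) s) (at s)"
      using assms unfolding frenet_frame_def by blast
    with 3 assms(4) show ?thesis
      by simp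
  qed
qed

lemma sum_shift_down:
  fixes F :: "nat \<Rightarrow> 'a::ab_group_add"
  assumes "F n = F 0"
  shows "(\<Sum>i=1..n. F (i - 1)) = (\<Sum>i=1..n. F i)"
proof -
  have "(\<Sum>i=1..n. F i) - (\<Sum>i=1..n. F (i - 1)) = F n - F 0"
    using sum_telescope''[of 0 n F] by (simp add: sum_subtractf)
  with assms show ?thesis
    by simp
qed

lemma frenet_combination_derivative:
  fixes V :: "nat \<Rightarrow> real \<Rightarrow> real ^ 'n"
  defines "K \<equiv> ext_curv CARD('n)"
  assumes "frenet_frame I \<alpha> V \<kappa>" "s \<in> I" "CARD('n) \<ge> 3"
    and "\<And>i. i \<in> {1..CARD('n)} \<Longrightarrow> (G i has_real_derivative G' i) (at s)"
  shows "((\<lambda>t. \<Sum>i=1..CARD('n). G i t *\<^sub>R V i t) has_vector_derivative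
    (\<Sum>i=1..CARD('n). (G' i + K \<kappa> (i - 1) s * G (i - 1) s - K \<kappa> i s * G (i + 1) s) *\<^sub>R V i s)) (at s)"
proof -
  let ?n = "CARD('n)"
  \<comment> \<open>By the Frenet equations, \<open>A i\<close> is the part of G_i V_i' along
    V_{i+1}, and \<open>B (i - 1)\<close> is minus its part along V_{i-1}.\<close>
  define A where "A = (\<lambda>i. (K \<kappa> i s * G i s) *\<^sub>R V (i + 1) s)"
  define B where "B = (\<lambda>i. (K \<kappa> i s * G (i + 1) s) *\<^sub>R V i s)"
  have "((\<lambda>t. \<Sum>i=1..?n. G i t *\<^sub>R V i t) has_vector_derivative
    (\<Sum>i=1..?n. G i s *\<^sub>R (K \<kappa> i s *\<^sub>R V (i + 1) s - K \<kappa> (i - 1) s *\<^sub>R V (i - 1) s)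
      + G' i *\<^sub>R V i s)) (at s)"
    unfolding K_def using assms
    by (intro has_vector_derivative_sum has_vector_derivative_scaleR frenet_frame_derivative) auto
  also have "(\<Sum>i=1..?n. G i s *\<^sub>R (K \<kappa> i s *\<^sub>R V (i + 1) s - K \<kappa> (i - 1) s *\<^sub>R V (i - 1) s)
      + G' i *\<^sub>R V i s) = (\<Sum>i=1..?n. A i - B (i - 1) + G' i *\<^sub>R V i s)"
    by (intro sum.cong) (auto simp: A_def B_def algebra_simps)
  also have "\<dots> = (\<Sum>i=1..?n. A i) - (\<Sum>i=1..?n. B (i - 1)) + (\<Sum>i=1..?n. G' i *\<^sub>R V i s)"
    by (simp add: sum.distrib sum_subtractf)
  \<comment> \<open>The shifts bring all terms to the common vector V_i; the boundary terms vanish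
    because the extended curvature is zero at both 0 and n.\<close>
  also have "\<dots> = (\<Sum>i=1..?n. A (i - 1)) - (\<Sum>i=1..?n. B i) + (\<Sum>i=1..?n. G' i *\<^sub>R V i s)"
    by (subst (1 2) sum_shift_down) (simp_all add: A_def B_def K_def)
  also have "\<dots> = (\<Sum>i=1..?n. A (i - 1) - B i + G' i *\<^sub>R V i s)"
    by (simp add: sum.distrib sum_subtractf)
  also have "\<dots> = (\<Sum>i=1..?n. (G' i + K \<kappa> (i - 1) s * G (i - 1) s - K \<kappa> i s * G (i + 1) s) *\<^sub>R V i s)"
    by (intro sum.cong) (auto simp: A_def B_def algebra_simps)
  finally show ?thesis .
qed

section \<open>The functions \<open>G\<^sub>i\<close>\<close>

lemma slant_G_Suc:
  assumes "3 \<le> i"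
  shows "slant_G \<kappa> g (Suc i) =
    (\<lambda>s. (\<kappa> (i - 1) s * slant_G \<kappa> g (i - 1) s + deriv (slant_G \<kappa> g i) s) / \<kappa> i s)"
proof -
  obtain k where "i = Suc (Suc (Suc k))"
    using assms by (metis Suc_le_D numeral_3_eq_3 Suc_le_mono)
  then show ?thesis
    by (simp add: numeral_3_eq_3 fun_eq_iff)
qed

lemma slant_G_numeral [simp]:
  "slant_G \<kappa> g 1 = g" "slant_G \<kappa> g 2 = (\<lambda>s. 1)" "slant_G \<kappa> g 3 = (\<lambda>s. \<kappa> 1 s / \<kappa> 2 s * g s)"
  by (simp_all add: numeral_2_eq_2 numeral_3_eq_3)

text \<open>The cases follow the defining equations of \<open>slant_G\<close>; the last one has the
  shape that \<open>slant_G_Suc\<close> rewrites.\<close>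

lemma index_cases:
  fixes i :: nat
  assumes "1 \<le> i"
  obtains (1) "i = 1" | (2) "i = 2" | (3) "i = 3" | (4) j where "3 \<le> j" "i = Suc j"
proof -
  have "i = 1 \<or> i = 2 \<or> i = 3 \<or> (3 \<le> i - 1 \<and> i = Suc (i - 1))"
    using assms by linarith
  then show ?thesis
    using that by blast
qed

text \<open>Strong induction, since the recursion reaches back two indices. Smoothness ensures that
  each \<open>deriv\<close> in the recursion is a genuine derivative.\<close>

lemma smooth_on_slant_G:
  assumes "open I" "\<And>i. i \<in> {1..<n} \<Longrightarrow> smooth_on I (\<kappa> i)"
    and "\<And>i s. \<lbrakk>i \<in> {1..<n}; s \<in> I\<rbrakk> \<Longrightarrow> \<kappa> i s \<noteq> 0"
    and "antiderivative_on I (\<kappa> 1) g" "1 \<le> i" "i \<le> n" "1 < n"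
  shows "smooth_on I (slant_G \<kappa> g i)"
  using assms(5,6)
proof (induction i rule: less_induct)
  case (less i)
  have g: "smooth_on I g"
    using assms by (intro smooth_on_antiderivative[OF _ _ assms(4)]) auto
  from \<open>1 \<le> i\<close> show ?case
  proof (cases rule: index_cases)
    case 3
    with less.prems have "smooth_on I (\<lambda>s. \<kappa> 1 s / \<kappa> 2 s * g s)"
      using assms by (intro smooth_on_mult smooth_on_divide g) auto
    with 3 show ?thesis
      by simp
  next
    case (4 j)
    have "smooth_on I (slant_G \<kappa> g (j - 1))" "smooth_on I (slant_G \<kappa> g j)"
      using 4 less.prems by (auto intro!: less.IH)
    moreover have "j - 1 \<in> {1..<n}" "j \<in> {1..<n}"
      using 4 less.prems by auto
    ultimately show ?thesis
      unfolding 4(2) slant_G_Suc[OF 4(1)] using assms(1-3)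
      by (intro smooth_on_divide smooth_on_add smooth_on_mult smooth_on_deriv) auto
  qed (simp_all add: g smooth_on_const assms(1))
qed

text \<open>The dummy value \<open>G\<^sub>0 = 0\<close> lets the Frenet-type recursion start at \<open>i = 1\<close>.\<close>

lemma slant_G_DERIV:
  assumes "open I" "\<And>i. i \<in> {1..<n} \<Longrightarrow> smooth_on I (\<kappa> i)"
    and "\<And>i s. \<lbrakk>i \<in> {1..<n}; s \<in> I\<rbrakk> \<Longrightarrow> \<kappa> i s \<noteq> 0"
    and "antiderivative_on I (\<kappa> 1) g" "1 \<le> i" "i < n" "s \<in> I"
  shows "(slant_G \<kappa> g i has_real_derivative
    \<kappa> i s * slant_G \<kappa> g (i + 1) s - \<kappa> (i - 1) s * slant_G \<kappa> g (i - 1) s) (at s)"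
proof -
  consider "i = 1" | "i = 2" | "3 \<le> i"
    using assms(5) by linarith
  then show ?thesis
  proof cases
    case 1
    with assms(4,7) show ?thesis
      by (simp add: antiderivative_on_def)
  next
    \<comment> \<open>G_2 is constant, and the claimed derivative cancels to 0 by the definition of
      G_3.\<close>
    case 2
    with assms(3)[of 2 s] assms(6,7) show ?thesis
      by simp
  next
    case 3
    have "(slant_G \<kappa> g i has_real_derivative deriv (slant_G \<kappa> g i) s) (at s)"
      using assms by (intro smooth_on_DERIV[OF smooth_on_slant_G[where n = n]]) auto
    with 3 assms(3)[of i s] assms(6,7) show ?thesis
      by (simp add: slant_G_Suc)
  qed
qed

text \<open>The defect \<open>G\<^sub>n' + \<kappa>\<^bsub>n-1\<^esub> G\<^bsub>n-1\<^esub>\<close> is the only obstruction to \<open>\<Sum> G\<^sub>i V\<^sub>i\<close> being constant.\<close>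

lemma slant_G_defect_eq_0:
  assumes "open I" "\<And>i. i \<in> {1..<n} \<Longrightarrow> smooth_on I (\<kappa> i)"
    and "\<And>i s. \<lbrakk>i \<in> {1..<n}; s \<in> I\<rbrakk> \<Longrightarrow> \<kappa> i s \<noteq> 0"
    and "antiderivative_on I (\<kappa> 1) g" "3 \<le> n"
    and sum: "\<And>s. s \<in> I \<Longrightarrow> (\<Sum>i=1..n. (slant_G \<kappa> g i s)\<^sup>2) = C"
    and "4 \<le> n \<Longrightarrow> nonzero_on_subintervals I (slant_G \<kappa> g n)" "s \<in> I"
  shows "deriv (slant_G \<kappa> g n) s + \<kappa> (n - 1) s * slant_G \<kappa> g (n - 1) s = 0"
proof -
  let ?G = "slant_G \<kappa> g"
  define R where "R = (\<lambda>s. deriv (?G n) s + \<kappa> (n - 1) s * ?G (n - 1) s)"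
  have smooth: "smooth_on I (?G i)" if "1 \<le> i" "i \<le> n" for i
    using assms that by (intro smooth_on_slant_G[where n = n]) auto
  have GR: "?G n s * R s = 0" if "s \<in> I" for s
  proof -
    \<comment> \<open>For i < n the recursion gives G_i G_i' = F_i - F_{i-1}, so half the derivative
      of the sum of squares telescopes up to its last term.\<close>
    define F where "F = (\<lambda>i. \<kappa> i s * ?G i s * ?G (i + 1) s)"
    have G': "(?G i has_real_derivative deriv (?G i) s) (at s)" if "i \<in> {1..n}" for i
      using smooth that \<open>s \<in> I\<close> by (intro smooth_on_DERIV) auto
    have "((\<lambda>s. \<Sum>i=1..n. (?G i s)\<^sup>2) has_real_derivative
        (\<Sum>i=1..n. 2 * (?G i s * deriv (?G i) s))) (at s)"
      by (rule DERIV_sum) (auto intro!: derivative_eq_intros G')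
    moreover have "((\<lambda>s. \<Sum>i=1..n. (?G i s)\<^sup>2) has_real_derivative 0) (at s)"
      by (rule DERIV_zero_if_constant_on_open[OF assms(1) that]) (rule sum)
    ultimately have "(\<Sum>i=1..n. 2 * (?G i s * deriv (?G i) s)) = 0"
      by (rule DERIV_unique)
    then have "0 = (\<Sum>i=1..n. ?G i s * deriv (?G i) s)"
      by (simp add: sum_distrib_left[symmetric])
    also have "\<dots> = (\<Sum>i=1..n-1. ?G i s * deriv (?G i) s) + ?G n s * deriv (?G n) s"
      using assms(5) by (cases n) auto
    also have "(\<Sum>i=1..n-1. ?G i s * deriv (?G i) s) = (\<Sum>i=1..n-1. F i - F (i - 1))"
    proof (rule sum.cong)
      fix i assume i: "i \<in> {1..n-1}"
      then have "deriv (?G i) s = \<kappa> i s * ?G (i + 1) s - \<kappa> (i - 1) s * ?G (i - 1) s"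
        using assms that by (intro DERIV_imp_deriv slant_G_DERIV[where n = n]) auto
      moreover have "F i - F (i - 1)
          = ?G i s * (\<kappa> i s * ?G (i + 1) s - \<kappa> (i - 1) s * ?G (i - 1) s)"
        using i by (simp add: F_def algebra_simps)
      ultimately show "?G i s * deriv (?G i) s = F i - F (i - 1)"
        by simp
    qed simp
    also have "\<dots> = F (n - 1) - F 0"
      using sum_telescope''[of 0 "n - 1" F] by simp
    \<comment> \<open>The term \<open>F 0\<close> vanishes through the dummy value G_0 = 0, whatever
      \<open>\<kappa> 0\<close> is.\<close>
    also have "\<dots> = \<kappa> (n - 1) s * ?G (n - 1) s * ?G n s"
      using assms(5) by (simp add: F_def)
    finally show ?thesis
      by (simp add: R_def algebra_simps)
  qed
  have "R s = 0"
  proof (cases "4 \<le> n")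
    case True
    have "smooth_on I (?G n)" "smooth_on I (?G (n - 1))" "smooth_on I (\<kappa> (n - 1))"
      using assms(5) by (auto intro!: smooth assms(2))
    then have "smooth_on I R"
      unfolding R_def by (intro smooth_on_add smooth_on_mult smooth_on_deriv assms(1))
    then have "isCont R s"
      using assms(8) by (rule smooth_on_isCont)
    with assms(1) assms(7)[OF True] GR assms(8) show ?thesis
      by (rule zero_on_open_of_mult_eq_0)
  next
    case False
    then have n: "n = 3"
      using assms(5) by simp
    have S: "(g t)\<^sup>2 + 1 + (\<kappa> 1 t / \<kappa> 2 t * g t)\<^sup>2 = C" if "t \<in> I" for t
      using sum[OF that] unfolding n
      by (simp add: numeral_3_eq_3 numeral_2_eq_2)
    \<comment> \<open>A zero of G_3 forces \<open>g s = 0\<close>, hence C = 1. Then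
      \<open>g\<close> vanishes on all of \<open>I\<close>, which contradicts g' = \<kappa>_1
      \<noteq> 0.\<close>
    have "?G 3 s \<noteq> 0"
    proof
      assume "?G 3 s = 0"
      then have "g s = 0"
        using assms(3)[of 1 s] assms(3)[of 2 s] assms(8) n by simp
      then have "C = 1"
        using S[OF assms(8)] by simp
      then have "g t = 0" if "t \<in> I" for t
        using S[OF that] sum_power2_eq_zero_iff[of "g t" "\<kappa> 1 t / \<kappa> 2 t * g t"] by simp
      then have "(g has_real_derivative 0) (at s)"
        by (intro DERIV_zero_if_constant_on_open[OF assms(1,8)]) auto
      then have "\<kappa> 1 s = 0"
        using assms(4,8) DERIV_unique unfolding antiderivative_on_def by blast
      with assms(3)[of 1 s] assms(8) n show False
        by simp
    qed
    with GR[OF assms(8)] n show ?thesis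
      by simp
  qed
  then show ?thesis
    by (simp add: R_def)
qed

section \<open>From a constant sum to a fixed axis\<close>

lemma slant_helix_of_constant_sum:
  fixes V :: "nat \<Rightarrow> real \<Rightarrow> real ^ 'n"
  assumes "3 \<le> CARD('n)" "open I" "is_interval I" "I \<noteq> {}"
    and smooth: "\<And>i. i \<in> {1..<CARD('n)} \<Longrightarrow> smooth_on I (\<kappa> i)"
    and frame: "frenet_frame I \<alpha> V \<kappa>"
    and nz: "\<And>i s. \<lbrakk>i \<in> {1..<CARD('n)}; s \<in> I\<rbrakk> \<Longrightarrow> \<kappa> i s \<noteq> 0"
    and g: "antiderivative_on I (\<kappa> 1) g"
    and sum: "\<And>s. s \<in> I \<Longrightarrow> (\<Sum>i=1..CARD('n). (slant_G \<kappa> g i s)\<^sup>2) = C"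
    and sub: "4 \<le> CARD('n) \<Longrightarrow> nonzero_on_subintervals I (slant_G \<kappa> g CARD('n))"
  shows "\<exists>U \<theta>. slant_helix_with I (V 2) U \<theta> \<and> cos \<theta> \<noteq> 0 \<and> C = (1 / cos \<theta>)\<^sup>2"
proof -
  let ?G = "slant_G \<kappa> g" and ?n = "CARD('n)"
  let ?K = "ext_curv ?n \<kappa>"
  define W where "W = (\<lambda>t. \<Sum>i=1..?n. ?G i t *\<^sub>R V i t)"
  have W': "(W has_vector_derivative 0) (at s)" if s: "s \<in> I" for s
  proof -
    have "(?G i has_real_derivative deriv (?G i) s) (at s)" if "i \<in> {1..?n}" for i
      using assms s that by (intro smooth_on_DERIV[OF smooth_on_slant_G[where n = ?n]]) auto
    from frenet_combination_derivative[OF frame s assms(1) this]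
    have "(W has_vector_derivative (\<Sum>i=1..?n. (deriv (?G i) s + ?K (i - 1) s * ?G (i - 1) s
        - ?K i s * ?G (i + 1) s) *\<^sub>R V i s)) (at s)"
      by (simp add: W_def)
    \<comment> \<open>The coefficient at i = n is the defect; below n it vanishes by the
      recursion.\<close>
    moreover have "deriv (?G i) s + ?K (i - 1) s * ?G (i - 1) s - ?K i s * ?G (i + 1) s = 0"
      if i: "i \<in> {1..?n}" for i
    proof (cases "i = ?n")
      case True
      then show ?thesis
        using slant_G_defect_eq_0[OF assms(2) smooth nz g assms(1) sum sub s] assms(1)
        by simp
    next
      case False
      then have "deriv (?G i) s = \<kappa> i s * ?G (i + 1) s - \<kappa> (i - 1) s * ?G (i - 1) s"
        using assms s i by (intro DERIV_imp_deriv slant_G_DERIV[where n = ?n]) auto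
      \<comment> \<open>At i = 1 the values \<open>?K 0 s\<close> and \<open>\<kappa> 0 s\<close>
        may differ, but both multiply G_0 = 0.\<close>
      moreover have "?K (i - 1) s * ?G (i - 1) s = \<kappa> (i - 1) s * ?G (i - 1) s"
        using i by (cases "i = 1") (auto simp: ext_curv_def)
      ultimately show ?thesis
        using False i by simp
    qed
    ultimately show ?thesis
      by simp
  qed
  have "\<exists>w. \<forall>s\<in>I. W s = w"
  proof (rule has_derivative_zero_constant)
    show "convex I"
      using assms(3) by (simp add: is_interval_convex_1)
    show "(W has_derivative (\<lambda>h. 0)) (at s within I)" if "s \<in> I" for s
      using W'[OF that] by (auto simp: has_vector_derivative_def intro: has_derivative_at_withinI)
  qed
  then obtain w where w: "\<And>s. s \<in> I \<Longrightarrow> W s = w"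
    by blast
  have VW: "V i s \<bullet> w = ?G i s" if "s \<in> I" "i \<in> {1..?n}" for i s
  proof -
    have "V i s \<bullet> w = (\<Sum>j=1..?n. ?G j s * (V i s \<bullet> V j s))"
      using w[OF that(1)] by (simp add: W_def inner_sum_right flip: w[OF that(1)])
    also have "\<dots> = (\<Sum>j=1..?n. if j = i then ?G j s else 0)"
      using frenet_frame_orthonormal[OF frame that(1)] that(2) by (intro sum.cong) auto
    finally show ?thesis
      using that by simp
  qed
  obtain s0 where s0: "s0 \<in> I"
    using assms(4) by blast
  have C: "w \<bullet> w = C"
    using orthonormal_parseval[OF frenet_frame_orthonormal[OF frame s0], of w] VW[OF s0] sum[OF s0]
    by simp
  \<comment> \<open>G_2 = 1 alone gives C \<ge> 1, so 1 / sqrt C lies in (0, 1] and is the cosine of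
    some angle.\<close>
  have "1 = (?G 2 s0)\<^sup>2"
    by simp
  also have "\<dots> \<le> C"
    unfolding sum[OF s0, symmetric] using assms(1) by (intro member_le_sum) auto
  finally have C1: "1 \<le> C" .
  define \<theta> where "\<theta> = arccos (1 / sqrt C)"
  have \<theta>: "cos \<theta> = 1 / sqrt C"
    unfolding \<theta>_def using C1 by (intro cos_arccos) (auto intro: order_trans[of _ 0])
  \<comment> \<open>The constant vector \<open>w\<close> has squared length C, so the axis is
    \<open>w\<close> normalised, and its product with V_2 is G_2 / sqrt C.\<close>
  have "slant_helix_with I (V 2) ((1 / sqrt C) *\<^sub>R w) \<theta>"
    unfolding slant_helix_with_def \<theta> using C C1 VW[of _ 2] assms(1) by (simp add: field_simps)
  moreover have "cos \<theta> \<noteq> 0" "C = (1 / cos \<theta>)\<^sup>2"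
    using C1 by (auto simp: \<theta>)
  ultimately show ?thesis
    by blast
qed

section \<open>The components of the axis of a slant helix\<close>

lemma constant_sum_of_slant_helix:
  fixes V :: "nat \<Rightarrow> real \<Rightarrow> real ^ 'n"
  assumes "3 \<le> CARD('n)" "open I"
    and frame: "frenet_frame I \<alpha> V \<kappa>"
    and nz: "\<And>i s. \<lbrakk>i \<in> {1..<CARD('n)}; s \<in> I\<rbrakk> \<Longrightarrow> \<kappa> i s \<noteq> 0"
    and helix: "slant_helix_with I (V 2) U \<theta>" and c: "cos \<theta> \<noteq> 0"
  shows "\<exists>g. antiderivative_on I (\<kappa> 1) g \<and>
    (\<forall>s\<in>I. (\<Sum>i=1..CARD('n). (slant_G \<kappa> g i s)\<^sup>2) = (1 / cos \<theta>)\<^sup>2) \<and>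
    nonzero_on_subintervals I (slant_G \<kappa> g CARD('n))"
proof -
  let ?n = "CARD('n)"
  let ?K = "ext_curv ?n \<kappa>"
  \<comment> \<open>Dividing by \<open>cos \<theta>\<close> normalises u_2 to G_2 = 1. Then u_1' =
    \<kappa>_1, so \<open>u 1\<close> is the antiderivative to choose.\<close>
  define u where "u = (\<lambda>i s. V i s \<bullet> U / cos \<theta>)"
  have u2: "u 2 s = 1" if "s \<in> I" for s
    using helix c that by (simp add: u_def slant_helix_with_def)
  have u': "(u i has_real_derivative ?K i s * u (i + 1) s - ?K (i - 1) s * u (i - 1) s) (at s)"
    if "s \<in> I" "i \<in> {1..?n}" for i s
  proof -
    have "((\<lambda>s. V i s \<bullet> U) has_vector_derivative
        (?K i s *\<^sub>R V (i + 1) s - ?K (i - 1) s *\<^sub>R V (i - 1) s) \<bullet> U) (at s)"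
      using bounded_linear.has_vector_derivative[OF bounded_linear_inner_left
          frenet_frame_derivative[OF frame that assms(1)]] .
    then have "((\<lambda>s. V i s \<bullet> U) has_real_derivative
        (?K i s *\<^sub>R V (i + 1) s - ?K (i - 1) s *\<^sub>R V (i - 1) s) \<bullet> U) (at s)"
      by (simp add: has_real_derivative_iff_has_vector_derivative)
    from DERIV_cdivide[OF this, of "cos \<theta>"] show ?thesis
      by (simp add: u_def inner_diff_left diff_divide_distrib)
  qed
  \<comment> \<open>Solving the Frenet equation of u_j for u_{j+1} gives the recursion. The point
    \<open>s\<close> stays arbitrary because comparing derivatives needs agreement on a
    neighbourhood.\<close>
  have G: "slant_G \<kappa> (u 1) i s = u i s" if "s \<in> I" "i \<in> {1..?n}" for i s
    using that
  proof (induction i arbitrary: s rule: less_induct)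
    case (less i)
    from less.prems have "1 \<le> i" by simp
    then show ?case
    proof (cases rule: index_cases)
      case 3
      \<comment> \<open>G_3 has its own defining formula: it expresses that u_2' = 0.\<close>
      have "(u 2 has_real_derivative 0) (at s)"
        by (rule DERIV_zero_if_constant_on_open[OF assms(2) less.prems(1)]) (rule u2)
      with u'[OF less.prems(1), of 2] assms(1)
      have "\<kappa> 2 s * u 3 s - \<kappa> 1 s * u 1 s = 0"
        by (auto dest: DERIV_unique simp: numeral_3_eq_3 numeral_2_eq_2)
      with nz[of 2 s] less.prems assms(1) 3 show ?thesis
        by (simp add: field_simps)
    next
      case (4 j)
      have "(slant_G \<kappa> (u 1) j has_real_derivative
          \<kappa> j s * u (j + 1) s - \<kappa> (j - 1) s * u (j - 1) s) (at s)"
      proof (rule has_field_derivative_transform_within_open[OF _ assms(2) less.prems(1)])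
        show "(u j has_real_derivative \<kappa> j s * u (j + 1) s - \<kappa> (j - 1) s * u (j - 1) s) (at s)"
          using u'[OF less.prems(1), of j] 4 less.prems by simp
        show "u j t = slant_G \<kappa> (u 1) j t" if "t \<in> I" for t
          using less.IH[of j t] 4 less.prems that by simp
      qed
      from DERIV_imp_deriv[OF this] show ?thesis
        using 4 less.prems less.IH[of "j - 1" s] nz[of j s]
        by (simp add: slant_G_Suc)
    qed (simp_all add: u2 less.prems)
  qed
  have "antiderivative_on I (\<kappa> 1) (u 1)"
    unfolding antiderivative_on_def
  proof
    fix s assume "s \<in> I"
    with u'[of s 1] u2[of s] assms(1) show "(u 1 has_real_derivative \<kappa> 1 s) (at s)"
      by (simp add: numeral_2_eq_2)
  qed
  moreover have "(\<Sum>i=1..?n. (slant_G \<kappa> (u 1) i s)\<^sup>2) = (1 / cos \<theta>)\<^sup>2" if "s \<in> I" for s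
  proof -
    have "(\<Sum>i=1..?n. (slant_G \<kappa> (u 1) i s)\<^sup>2) = (\<Sum>i=1..?n. (V i s \<bullet> U)\<^sup>2) / (cos \<theta>)\<^sup>2"
      using G[OF that] by (simp add: u_def power_divide sum_divide_distrib)
    also have "\<dots> = U \<bullet> U / (cos \<theta>)\<^sup>2"
      by (subst orthonormal_parseval[OF frenet_frame_orthonormal[OF frame that]]) auto
    finally show ?thesis
      using helix by (simp add: slant_helix_with_def power_divide)
  qed
  moreover have "nonzero_on_subintervals I (slant_G \<kappa> (u 1) ?n)"
    unfolding nonzero_on_subintervals_def
  proof (intro allI impI, rule ccontr)
    fix a b :: real
    assume ab: "a < b \<and> {a<..<b} \<subseteq> I" and "\<not> (\<exists>s\<in>{a<..<b}. slant_G \<kappa> (u 1) ?n s \<noteq> 0)"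
    then have un: "u ?n s = 0" if "s \<in> {a<..<b}" for s
      using G[of s ?n] that assms(1) by (auto simp: subset_iff)
    \<comment> \<open>The descent carries two consecutive zeros, since the equation for u_i links
      u_{i+1}, u_i' and u_{i-1}. The bound on \<open>k\<close> keeps the lower index at least
      2.\<close>
    have step: "\<forall>s\<in>{a<..<b}. u (?n - k) s = 0 \<and> u (?n - Suc k) s = 0" if "k + 3 \<le> ?n" for k
      using that
    proof (induction k)
      case 0
      have "u (?n - 1) s = 0" if s: "s \<in> {a<..<b}" for s
      proof -
        have "(u ?n has_real_derivative 0) (at s)"
          by (rule DERIV_zero_if_constant_on_open[OF _ s]) (auto simp: un)
        with u'[of s ?n] s ab assms(1) have "\<kappa> (?n - 1) s * u (?n - 1) s = 0"
          by (auto dest: DERIV_unique simp: subset_iff)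
        with nz[of "?n - 1" s] s ab assms(1) show ?thesis
          by (auto simp: subset_iff)
      qed
      with un show ?case by simp
    next
      case (Suc k)
      have IH: "u (?n - k) s = 0" "u (?n - Suc k) s = 0" if "s \<in> {a<..<b}" for s
        using Suc that by auto
      define i where "i = ?n - Suc k"
      have i: "i \<in> {3..<?n}" "?n - k = i + 1" "?n - Suc (Suc k) = i - 1"
        using Suc.prems by (auto simp: i_def)
      have "u (i - 1) s = 0" if s: "s \<in> {a<..<b}" for s
      proof -
        \<comment> \<open>Vanishing of u_i on the whole interval kills u_i', and u_{i+1} = 0, so
          only \<kappa>_{i-1} u_{i-1} is left.\<close>
        have "(u i has_real_derivative 0) (at s)"
          by (rule DERIV_zero_if_constant_on_open[OF _ s]) (use IH in \<open>auto simp: i_def\<close>)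
        with u'[of s i] s ab i have "\<kappa> i s * u (i + 1) s - \<kappa> (i - 1) s * u (i - 1) s = 0"
          by (auto dest: DERIV_unique simp: subset_iff)
        moreover have "\<kappa> (i - 1) s \<noteq> 0"
          by (rule nz) (use s ab i in auto)
        ultimately show ?thesis
          using IH(1)[OF s] i by simp
      qed
      with IH(2) i(3) show ?case
        by simp
    qed
    \<comment> \<open>The last descent step, \<open>k = ?n - 3\<close>, reaches the indices 3 and 2,
      against u_2 = 1.\<close>
    have "\<forall>s\<in>{a<..<b}. u 2 s = 0"
      using step[of "?n - 3"] assms(1) by (simp add: Suc_diff_Suc numeral_3_eq_3 numeral_2_eq_2)
    moreover have "(a + b) / 2 \<in> {a<..<b}" "(a + b) / 2 \<in> I"
      using ab by auto
    ultimately show False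
      using u2 by force
  qed
  ultimately show ?thesis
    by blast
qed

text \<open>An axis orthogonal to V_2 has no sec \<theta>, hence the condition on
  \<open>cos \<theta>\<close>. The clause on G_n rules out sums that are constant although the
  defect is nonzero; for n = 3 a constant sum already keeps G_3 away from zero. The last two
  conjuncts identify C with sec^2 \<theta>, starting from the axis and from the sum
  respectively.\<close>

theorem theorem1p2:
  fixes I :: "real set"
    and \<alpha> :: "real \<Rightarrow> real ^ 'n"
    and V :: "nat \<Rightarrow> real \<Rightarrow> real ^ 'n"
    and \<kappa> :: "nat \<Rightarrow> real \<Rightarrow> real"
  assumes "CARD('n) \<ge> 3"
    and "open I" and "is_interval I" and "I \<noteq> {}"
    and "smooth_on I \<alpha>"
    and "\<forall>i\<in>{1..CARD('n) - 1}. smooth_on I (\<kappa> i)"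
    and "unit_speed_on I \<alpha>"
    and "frenet_frame I \<alpha> V \<kappa>"
    and "\<forall>i\<in>{1..CARD('n) - 1}. \<forall>s\<in>I. \<kappa> i s \<noteq> 0"
  shows
    "((\<exists>U \<theta>. slant_helix_with I (V 2) U \<theta> \<and> cos \<theta> \<noteq> 0) \<longleftrightarrow>
      (\<exists>G\<^sub>1 C. antiderivative_on I (\<kappa> 1) G\<^sub>1 \<and>
         (\<forall>s\<in>I. (\<Sum>i=1..CARD('n). (slant_G \<kappa> G\<^sub>1 i s)\<^sup>2) = C) \<and> C \<noteq> 0 \<and>
         (CARD('n) \<ge> 4 \<longrightarrow> nonzero_on_subintervals I (slant_G \<kappa> G\<^sub>1 CARD('n))))) \<and>
     (\<forall>U \<theta>. slant_helix_with I (V 2) U \<theta> \<and> cos \<theta> \<noteq> 0 \<longrightarrow>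
      (\<exists>G\<^sub>1. antiderivative_on I (\<kappa> 1) G\<^sub>1 \<and>
         (\<forall>s\<in>I. (\<Sum>i=1..CARD('n). (slant_G \<kappa> G\<^sub>1 i s)\<^sup>2) = (1 / cos \<theta>)\<^sup>2) \<and>
         (CARD('n) \<ge> 4 \<longrightarrow> nonzero_on_subintervals I (slant_G \<kappa> G\<^sub>1 CARD('n))))) \<and>
     (\<forall>G\<^sub>1 C. antiderivative_on I (\<kappa> 1) G\<^sub>1 \<and>
         (\<forall>s\<in>I. (\<Sum>i=1..CARD('n). (slant_G \<kappa> G\<^sub>1 i s)\<^sup>2) = C) \<and> C \<noteq> 0 \<and>
         (CARD('n) \<ge> 4 \<longrightarrow> nonzero_on_subintervals I (slant_G \<kappa> G\<^sub>1 CARD('n))) \<longrightarrow>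
      (\<exists>U \<theta>. slant_helix_with I (V 2) U \<theta> \<and> cos \<theta> \<noteq> 0 \<and> C = (1 / cos \<theta>)\<^sup>2))"
proof -
  have smooth: "smooth_on I (\<kappa> i)" if "i \<in> {1..<CARD('n)}" for i
    using assms(6) that by auto
  have nz: "\<kappa> i s \<noteq> 0" if "i \<in> {1..<CARD('n)}" "s \<in> I" for i s
    using assms(9) that by auto
  have helix: "\<exists>U \<theta>. slant_helix_with I (V 2) U \<theta> \<and> cos \<theta> \<noteq> 0 \<and> C = (1 / cos \<theta>)\<^sup>2"
    if "antiderivative_on I (\<kappa> 1) g"
      "\<forall>s\<in>I. (\<Sum>i=1..CARD('n). (slant_G \<kappa> g i s)\<^sup>2) = C"
      "CARD('n) \<ge> 4 \<longrightarrow> nonzero_on_subintervals I (slant_G \<kappa> g CARD('n))" for g C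
    using that by (intro slant_helix_of_constant_sum[OF assms(1-4) smooth assms(8) nz]) auto
  have const: "\<exists>g. antiderivative_on I (\<kappa> 1) g \<and>
      (\<forall>s\<in>I. (\<Sum>i=1..CARD('n). (slant_G \<kappa> g i s)\<^sup>2) = (1 / cos \<theta>)\<^sup>2) \<and>
      nonzero_on_subintervals I (slant_G \<kappa> g CARD('n))"
    if "slant_helix_with I (V 2) U \<theta>" "cos \<theta> \<noteq> 0" for U \<theta>
    using that by (intro constant_sum_of_slant_helix[OF assms(1,2,8) nz]) auto
  show ?thesis
  proof (intro conjI)
    show "(\<exists>U \<theta>. slant_helix_with I (V 2) U \<theta> \<and> cos \<theta> \<noteq> 0) \<longleftrightarrow>
      (\<exists>G\<^sub>1 C. antiderivative_on I (\<kappa> 1) G\<^sub>1 \<and>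
         (\<forall>s\<in>I. (\<Sum>i=1..CARD('n). (slant_G \<kappa> G\<^sub>1 i s)\<^sup>2) = C) \<and> C \<noteq> 0 \<and>
         (CARD('n) \<ge> 4 \<longrightarrow> nonzero_on_subintervals I (slant_G \<kappa> G\<^sub>1 CARD('n))))"
      (is "?L \<longleftrightarrow> ?R")
    proof
      assume ?L
      then obtain U \<theta> where U: "slant_helix_with I (V 2) U \<theta>" "cos \<theta> \<noteq> 0"
        by blast
      from U(2) have "(1 / cos \<theta>)\<^sup>2 \<noteq> 0"
        by simp
      with const[OF U] show ?R
        by blast
    next
      assume ?R
      then show ?L
        using helix by blast
    qed
  qed (use const helix in blast)+
qed

end
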